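(* Let $n\ge 1$ and for each $1\le i<j\le n$ let $m_{ij}\in\mathbb{R}\cup\{-\infty\}$ and $M_{ij}\in\mathbb{R}\cup\{\infty\}$ with $m_{ij}<M_{ij}$. The weighted digraphical polytope given by the system of inequalities $$m_{ij}<x_i-x_j<M_{ij},\quad 1\le i<j\le n,$$ is not empty if and only if the weighted digraph associated to this system is $m$-acyclic.
   Context: $V_{n-1}=\{x\in\mathbb{R}^n: x_1+\cdots+x_n=0\}$. The weighted digraphical polytope given by a system $m_{ij}<x_i-x_j<M_{ij}$ ($1\le i<j\le n$) is its solution set in $V_{n-1}$. The weighted digraph associated to the system has vertex set $\{1,\ldots,n\}$; for each $i<j$ it has a directed edge $i\rightarrow j$ of weight $m_{ij}$ if $m_{ij}>-\infty$, and a directed edge $j\rightarrow i$ of weight $-M_{ij}$ if $M_{ij}<\infty$; it has no other edges. An $m$-ascending cycle in the associated weighted digraph is a directed cycle along which the sum of the weights is nonnegative. The weighted digraph is $m$-acyclic if it contains no $m$-ascending cycle. (Here "$m$-" is just part of the name.) *)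

theory Defs
  imports
    "HOL-Library.FuncSet"
    "HOL-Library.Extended_Real"
    "Graph_Theory.Weighted_Graph"
begin

text \<open>
  A point of the \<open>n\<close>-dimensional real space is an extensional function on \<open>{1..n}\<close>.
  Bounds \<open>m\<close>, \<open>M\<close> are functions into the extended reals of which only the values at
  \<open>1 \<le> i < j \<le> n\<close> matter.
\<close>

definition zero_sum_space :: "nat \<Rightarrow> (nat \<Rightarrow> real) set" where
  "zero_sum_space n = {x \<in> {1..n} \<rightarrow>\<^sub>E UNIV. (\<Sum>i = 1..n. x i) = 0}"

definition weighted_digraphical_polytope ::
  "nat \<Rightarrow> (nat \<Rightarrow> nat \<Rightarrow> ereal) \<Rightarrow> (nat \<Rightarrow> nat \<Rightarrow> ereal) \<Rightarrow> (nat \<Rightarrow> real) set" where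
  "weighted_digraphical_polytope n m M =
    {x \<in> zero_sum_space n. \<forall>i j. 1 \<le> i \<and> i < j \<and> j \<le> n \<longrightarrow>
       m i j < ereal (x i - x j) \<and> ereal (x i - x j) < M i j}"

definition assoc_digraph ::
  "nat \<Rightarrow> (nat \<Rightarrow> nat \<Rightarrow> ereal) \<Rightarrow> (nat \<Rightarrow> nat \<Rightarrow> ereal) \<Rightarrow> (nat, nat \<times> nat) pre_digraph" where
  "assoc_digraph n m M =
    \<lparr> verts = {1..n},
      arcs = {(i, j) | i j. 1 \<le> i \<and> i < j \<and> j \<le> n \<and> m i j > -\<infinity>}
           \<union> {(j, i) | i j. 1 \<le> i \<and> i < j \<and> j \<le> n \<and> M i j < \<infinity>},
      tail = fst, head = snd \<rparr>"

text \<open>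
  On arcs of the associated digraph the bound involved is finite (given \<open>m i j < M i j\<close>),
  so \<open>real_of_ereal\<close> does not lose information there.
\<close>

definition assoc_weight ::
  "(nat \<Rightarrow> nat \<Rightarrow> ereal) \<Rightarrow> (nat \<Rightarrow> nat \<Rightarrow> ereal) \<Rightarrow> (nat \<times> nat) weight_fun" where
  "assoc_weight m M = (\<lambda>(a, b). if a < b then real_of_ereal (m a b) else - real_of_ereal (M b a))"

definition m_ascending_cycle ::
  "('a, 'b) pre_digraph \<Rightarrow> 'b weight_fun \<Rightarrow> 'b awalk \<Rightarrow> bool" where
  "m_ascending_cycle G w p \<longleftrightarrow> pre_digraph.cycle G p \<and> wf_digraph.awalk_cost w p \<ge> 0"

definition m_acyclic :: "('a, 'b) pre_digraph \<Rightarrow> 'b weight_fun \<Rightarrow> bool" where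
  "m_acyclic G w \<longleftrightarrow> (\<nexists>p. m_ascending_cycle G w p)"

lemma wf_digraph_assoc_digraph: "wf_digraph (assoc_digraph n m M)"
  by unfold_locales (auto simp: assoc_digraph_def)

end

theory Submission
  imports Defs "Graph_Theory.Shortest_Path"
begin

text \<open>
  Write every inequality of the system as \<open>w e < x (tail e) - x (head e)\<close> for an arc \<open>e\<close> of the
  associated digraph: the lower bounds give the ascending arcs, the upper bounds the descending
  ones, and infinite bounds give no arc and no condition. A solution is then a potential on the
  vertices that drops along each arc by more than the weight of the arc, and the theorem is the
  fact, valid in every finite weighted digraph (\<open>potential_iff_m_acyclic\<close>), that such a potential
  exists iff every cycle has negative weight.

  Along a cycle the drops of a potential telescope to 0, so they cannot all exceed the weights if
  these add up to at least 0. Conversely, let all cycles have negative weight. There are finitely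
  many cycles, so all weights can be increased by some \<open>\<epsilon> > 0\<close> while cycles keep weight at most 0
  (\<open>uniform_cycle_slack\<close>). Let \<open>x v\<close> be the largest new weight of a path that starts at \<open>v\<close>.
  Putting an arc \<open>e\<close> in front of an optimal path from \<open>head e\<close> gives a walk from \<open>tail e\<close>; deleting
  its closed subwalks does not lower its weight, so \<open>x (tail e) \<ge> w e + \<epsilon> + x (head e)\<close>. This is
  the longest-path dual of the usual shortest-path potential, and \<open>\<epsilon>\<close> makes the inequality strict.

  Only differences \<open>x i - x j\<close> occur, so a solution may be shifted into the zero-sum space.
\<close>

section \<open>Weights of closed walks\<close>

context wf_digraph
begin

lemma awalk_cost_add_const:
  "awalk_cost (\<lambda>e. w e + c) p = awalk_cost w p + c * length p"
  by (induction p) (auto simp: algebra_simps)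

lemma awalk_cost_uminus: "awalk_cost (\<lambda>e. - w e) p = - awalk_cost w p"
  by (induction p) auto

text \<open>
  A closed walk that visits a vertex twice splits into two shorter closed walks, so its weight is
  a sum of weights of cycles.
\<close>
lemma closed_walk_cost_nonpos:
  assumes cyc: "\<And>c. cycle c \<Longrightarrow> awalk_cost w c \<le> 0"
    and "awalk u p u"
  shows "awalk_cost w p \<le> 0"
  using assms(2)
proof (induction "length p" arbitrary: u p rule: less_induct)
  case less
  show ?case
  proof (cases p)
    case Nil
    then show ?thesis by simp
  next
    case (Cons e es)
    show ?thesis
    proof (cases "distinct (tl (awalk_verts u p))")
      case True
      then have "cycle p" using less.prems Cons by (auto simp: cycle_def)
      then show ?thesis by (rule cyc)
    next
      case False
      with Cons less.prems have es: "awalk (head G e) es u"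
        "\<not> distinct (awalk_verts (head G e) es)" and e: "e \<in> arcs G" "u = tail G e"
        by (auto simp: awalk_Cons_iff)
      obtain q r s v where qrs: "es = q @ r @ s" and r: "length r > 0" "awalk v r v"
        and qs: "awalk (head G e) q v" "awalk v s u"
        using awalk_not_distinct_decomp[OF es] by auto
      have "awalk (head G e) (q @ s) u"
        using qs by (rule awalk_appendI)
      with e have "awalk u (e # q @ s) u" by (simp add: awalk_Cons_iff del: awalk_append_iff)
      then have "awalk_cost w (e # q @ s) \<le> 0"
        using less.hyps[of "e # q @ s" u] r(1) Cons qrs by simp
      moreover have "awalk_cost w r \<le> 0"
        using less.hyps[of r v] r(2) Cons qrs by simp
      ultimately show ?thesis using Cons qrs by simp
    qed
  qed
qed

section \<open>Potentials\<close>

lemma awalk_cost_less_potential_drop: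
  assumes "\<And>e. e \<in> arcs G \<Longrightarrow> w e < x (tail G e) - x (head G e)"
    and "awalk u p v" "p \<noteq> []"
  shows "awalk_cost w p < x u - x v"
  using assms(2,3)
proof (induction p arbitrary: u)
  case (Cons e p)
  then have e: "w e < x u - x (head G e)" and p: "awalk (head G e) p v"
    using assms(1)[of e] by (auto simp: awalk_Cons_iff)
  show ?case
  proof (cases "p = []")
    case True
    then show ?thesis using e p by (auto simp: awalk_Nil_iff)
  next
    case False
    then show ?thesis using Cons.IH[OF p] e by simp
  qed
qed simp

lemma potential_imp_m_acyclic:
  assumes "\<And>e. e \<in> arcs G \<Longrightarrow> w e < x (tail G e) - x (head G e)"
  shows "m_acyclic G w"
  using awalk_cost_less_potential_drop[where w = w and x = x, OF assms]
  unfolding m_acyclic_def m_ascending_cycle_def cycle_def by fastforce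

end

context fin_digraph
begin

lemma finite_cycles: "finite {p. cycle p}"
proof (rule finite_subset)
  show "{p. cycle p} \<subseteq> {p. set p \<subseteq> arcs G \<and> distinct p}"
    by (auto simp: cycle_conv awalk_def)
  show "finite {p. set p \<subseteq> arcs G \<and> distinct p}"
    using finite_subset_distinct[OF finite_arcs] .
qed

lemma uniform_cycle_slack:
  assumes "m_acyclic G w"
  obtains \<epsilon> where "\<epsilon> > 0" "\<And>p. cycle p \<Longrightarrow> awalk_cost (\<lambda>e. w e + \<epsilon>) p \<le> 0"
proof -
  have neg: "awalk_cost w p < 0" "length p > 0" if "cycle p" for p
    using that assms by (auto simp: m_acyclic_def m_ascending_cycle_def cycle_def not_le)
  \<comment> \<open>The smallest negated mean weight of a cycle; the 1 covers the case without cycles.\<close>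
  define \<epsilon> where "\<epsilon> = Min (insert 1 ((\<lambda>p. - awalk_cost w p / length p) ` {p. cycle p}))"
  have "\<epsilon> > 0"
    unfolding \<epsilon>_def using finite_cycles neg by (subst Min_gr_iff) (auto simp: divide_neg_pos)
  moreover have "awalk_cost (\<lambda>e. w e + \<epsilon>) p \<le> 0" if "cycle p" for p
  proof -
    have "\<epsilon> \<le> - awalk_cost w p / length p"
      unfolding \<epsilon>_def using finite_cycles that by (intro Min_le) auto
    then show ?thesis
      unfolding awalk_cost_add_const using neg[OF that] by (simp add: field_simps)
  qed
  ultimately show ?thesis by (rule that)
qed

text \<open>
  The potential of a vertex is the largest weight of a path starting there. Paths instead of walks
  make this a maximum over a finite set.
\<close>
lemma longest_path_potential:
  assumes "\<And>c. cycle c \<Longrightarrow> awalk_cost w c \<le> 0"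
  obtains x where "\<And>e. e \<in> arcs G \<Longrightarrow> w e \<le> x (tail G e) - x (head G e)"
proof -
  define P where "P v = {p. \<exists>u. apath v p u}" for v
  have fin: "finite (P v)" for v
  proof (rule finite_subset)
    show "P v \<subseteq> (fst \<circ> snd) ` {(u, p, v). apath u p v}"
      by (force simp: P_def)
  qed (use apaths_finite_triple in simp)
  define x where "x v = Max (awalk_cost w ` P v)" for v
  have "w e \<le> x (tail G e) - x (head G e)" if e: "e \<in> arcs G" for e
  proof -
    have "[] \<in> P (head G e)"
      using e by (auto simp: P_def apath_Nil_iff)
    then have "x (head G e) \<in> awalk_cost w ` P (head G e)"
      unfolding x_def using fin by (intro Max_in) auto
    then obtain p u where p: "apath (head G e) p u" "x (head G e) = awalk_cost w p"
      by (auto simp: P_def)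
    then have walk: "awalk (tail G e) (e # p) u"
      using e by (simp add: awalk_Cons_iff apath_def)
    \<comment> \<open>Negated weights turn the fact that shortcutting a walk to a path does not raise its cost,
      in the absence of negative closed walks, into the required statement on longest paths.\<close>
    have "awalk_cost (\<lambda>e. - w e) (awalk_to_apath (e # p)) \<le> awalk_cost (\<lambda>e. - w e) (e # p)"
      using walk closed_walk_cost_nonpos[OF assms]
      by (intro awalk_to_path_no_neg_cyc_cost) (auto simp: awalk_cost_uminus not_less)
    then have "awalk_cost w (e # p) \<le> awalk_cost w (awalk_to_apath (e # p))"
      by (simp only: awalk_cost_uminus)
    also have "\<dots> \<le> x (tail G e)"
      unfolding x_def using fin apath_awalk_to_apath[OF walk] by (intro Max_ge) (auto simp: P_def)
    finally show ?thesis using p(2) by simp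
  qed
  then show ?thesis by (rule that)
qed

theorem potential_iff_m_acyclic:
  "(\<exists>x. \<forall>e \<in> arcs G. w e < x (tail G e) - x (head G e)) \<longleftrightarrow> m_acyclic G w"
proof
  assume "m_acyclic G w"
  then obtain \<epsilon> where \<epsilon>: "\<epsilon> > 0" "\<And>p. cycle p \<Longrightarrow> awalk_cost (\<lambda>e. w e + \<epsilon>) p \<le> 0"
    by (rule uniform_cycle_slack) blast
  obtain x where "\<And>e. e \<in> arcs G \<Longrightarrow> w e + \<epsilon> \<le> x (tail G e) - x (head G e)"
    using longest_path_potential[OF \<epsilon>(2)] by blast
  then have "\<forall>e \<in> arcs G. w e < x (tail G e) - x (head G e)"
    using \<epsilon>(1) by fastforce
  then show "\<exists>x. \<forall>e \<in> arcs G. w e < x (tail G e) - x (head G e)" by blast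
next
  assume "\<exists>x. \<forall>e \<in> arcs G. w e < x (tail G e) - x (head G e)"
  then obtain x where "\<And>e. e \<in> arcs G \<Longrightarrow> w e < x (tail G e) - x (head G e)"
    by blast
  then show "m_acyclic G w" by (rule potential_imp_m_acyclic)
qed

end

section \<open>Weighted digraphical polytopes\<close>

lemma fin_digraph_assoc_digraph: "fin_digraph (assoc_digraph n m M)"
proof -
  interpret wf_digraph "assoc_digraph n m M" by (rule wf_digraph_assoc_digraph)
  have "arcs (assoc_digraph n m M) \<subseteq> {1..n} \<times> {1..n}"
    by (auto simp: assoc_digraph_def)
  then have "finite (arcs (assoc_digraph n m M))"
    by (rule finite_subset) simp
  then show ?thesis
    by unfold_locales (auto simp: assoc_digraph_def)
qed

lemma ball_arcs_assoc_digraph: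
  "(\<forall>e \<in> arcs (assoc_digraph n m M). P e) \<longleftrightarrow>
   (\<forall>i j. 1 \<le> i \<and> i < j \<and> j \<le> n \<longrightarrow>
      (m i j > -\<infinity> \<longrightarrow> P (i, j)) \<and> (M i j < \<infinity> \<longrightarrow> P (j, i)))"
  unfolding assoc_digraph_def pre_digraph.simps by blast

lemma system_iff_potential:
  assumes "\<And>i j. 1 \<le> i \<Longrightarrow> i < j \<Longrightarrow> j \<le> n \<Longrightarrow> m i j \<noteq> \<infinity>"
    and "\<And>i j. 1 \<le> i \<Longrightarrow> i < j \<Longrightarrow> j \<le> n \<Longrightarrow> M i j \<noteq> -\<infinity>"
  shows "(\<forall>i j. 1 \<le> i \<and> i < j \<and> j \<le> n \<longrightarrow>
            m i j < ereal (x i - x j) \<and> ereal (x i - x j) < M i j) \<longleftrightarrow>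
         (\<forall>e \<in> arcs (assoc_digraph n m M).
            assoc_weight m M e < x (tail (assoc_digraph n m M) e) - x (head (assoc_digraph n m M) e))"
proof -
  have lower: "m i j < ereal r \<longleftrightarrow> (m i j > -\<infinity> \<longrightarrow> assoc_weight m M (i, j) < r)"
    if "1 \<le> i" "i < j" "j \<le> n" for i j r
    using assms(1)[OF that] that by (cases "m i j") (auto simp: assoc_weight_def)
  have upper: "ereal r < M i j \<longleftrightarrow> (M i j < \<infinity> \<longrightarrow> assoc_weight m M (j, i) < - r)"
    if "1 \<le> i" "i < j" "j \<le> n" for i j r
    using assms(2)[OF that] that by (cases "M i j") (auto simp: assoc_weight_def)
  have "(\<forall>i j. 1 \<le> i \<and> i < j \<and> j \<le> n \<longrightarrow>
            m i j < ereal (x i - x j) \<and> ereal (x i - x j) < M i j) \<longleftrightarrow>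
        (\<forall>i j. 1 \<le> i \<and> i < j \<and> j \<le> n \<longrightarrow>
            (m i j > -\<infinity> \<longrightarrow> assoc_weight m M (i, j) < x i - x j) \<and>
            (M i j < \<infinity> \<longrightarrow> assoc_weight m M (j, i) < x j - x i))"
    using lower upper by (metis minus_diff_eq)
  also have "\<dots> \<longleftrightarrow> (\<forall>e \<in> arcs (assoc_digraph n m M).
      assoc_weight m M e < x (tail (assoc_digraph n m M) e) - x (head (assoc_digraph n m M) e))"
    unfolding ball_arcs_assoc_digraph by (simp add: assoc_digraph_def)
  finally show ?thesis .
qed

text \<open>Subtracting the mean leaves all differences unchanged.\<close>
lemma polytope_nonempty_iff_solvable:
  assumes "n \<ge> 1"
  shows "weighted_digraphical_polytope n m M \<noteq> {} \<longleftrightarrow>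
         (\<exists>x :: nat \<Rightarrow> real. \<forall>i j. 1 \<le> i \<and> i < j \<and> j \<le> n \<longrightarrow>
            m i j < ereal (x i - x j) \<and> ereal (x i - x j) < M i j)"
    (is "_ \<longleftrightarrow> (\<exists>x. ?sol x)")
proof
  assume "weighted_digraphical_polytope n m M \<noteq> {}"
  then show "\<exists>x. ?sol x"
    unfolding weighted_digraphical_polytope_def by blast
next
  assume "\<exists>x. ?sol x"
  then obtain x where x: "?sol x" ..
  define y where "y = restrict (\<lambda>i. x i - (\<Sum>k = 1..n. x k) / n) {1..n}"
  have "(\<Sum>i = 1..n. y i) = 0"
    using assms by (simp add: y_def sum_subtractf)
  then have "y \<in> zero_sum_space n"
    by (simp add: zero_sum_space_def y_def)
  moreover have "y i - y j = x i - x j" if "1 \<le> i" "i < j" "j \<le> n" for i j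
    using that by (simp add: y_def)
  then have "?sol y" using x by simp
  ultimately show "weighted_digraphical_polytope n m M \<noteq> {}"
    unfolding weighted_digraphical_polytope_def by blast
qed

theorem theorem2p5:
  fixes n :: nat and m M :: "nat \<Rightarrow> nat \<Rightarrow> ereal"
  assumes "n \<ge> 1"
    and "\<And>i j. 1 \<le> i \<Longrightarrow> i < j \<Longrightarrow> j \<le> n \<Longrightarrow> m i j \<noteq> \<infinity>"
    and "\<And>i j. 1 \<le> i \<Longrightarrow> i < j \<Longrightarrow> j \<le> n \<Longrightarrow> M i j \<noteq> -\<infinity>"
    and "\<And>i j. 1 \<le> i \<Longrightarrow> i < j \<Longrightarrow> j \<le> n \<Longrightarrow> m i j < M i j"
  shows "weighted_digraphical_polytope n m M \<noteq> {} \<longleftrightarrow>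
         m_acyclic (assoc_digraph n m M) (assoc_weight m M)"
proof -
  note system = system_iff_potential[of n m M, OF assms(2,3)]
  have "weighted_digraphical_polytope n m M \<noteq> {} \<longleftrightarrow>
      (\<exists>x. \<forall>e \<in> arcs (assoc_digraph n m M). assoc_weight m M e <
          x (tail (assoc_digraph n m M) e) - x (head (assoc_digraph n m M) e))"
    unfolding polytope_nonempty_iff_solvable[OF assms(1)] by (intro ex_cong1 system)
  also have "\<dots> \<longleftrightarrow> m_acyclic (assoc_digraph n m M) (assoc_weight m M)"
    by (rule fin_digraph.potential_iff_m_acyclic[OF fin_digraph_assoc_digraph])
  finally show ?thesis .
qed

end
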